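(* Let $\mathscr{A}$ be an infinite set of positive integers. For every positive integer $n$, let $\tau_n$ denote the smallest element of $\mathscr{A}$ which does not divide $n$. Then $$\lim_{N \rightarrow + \infty} \frac{1}{N} \sum_{n = 1}^{N} \tau_n = \sum_{n = 0}^{\infty} \frac{1}{\operatorname{lcm}\{a \in \mathscr{A} \mid a \leq n\}},$$ both when the series on the right-hand side converges and when it diverges (in the latter case, the equality means that the averages on the left-hand side tend to $+\infty$).
   Context: The least common multiple of the empty set is, by convention, equal to $1$. *)

theory Defs
  imports Complex_Main
begin

definition smallest_nondivisor :: "nat set \<Rightarrow> nat \<Rightarrow> nat" where
  "smallest_nondivisor A n = (LEAST a. a \<in> A \<and> \<not> a dvd n)"

end

theory Submission imports Defs
begin

text \<open>
  Write \<open>L m\<close> for the least common multiple of the elements of \<open>A\<close> up to \<open>m\<close> and \<open>\<tau> n\<close> for the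
  smallest element of \<open>A\<close> not dividing \<open>n\<close>. Saying that \<open>\<tau> n\<close> exceeds \<open>m\<close> is the same as saying that
  \<open>L m\<close> divides \<open>n\<close>. Hence \<open>\<tau> n\<close>, being the number of \<open>m\<close> below it, counts the \<open>m\<close> with
  \<open>L m dvd n\<close>. Summing over \<open>1 \<le> n \<le> N\<close> and exchanging the sums gives
  \<open>\<Sum>n=1..N. \<tau> n = \<Sum>m. N div L m\<close>, a sum with finitely many nonzero terms
  (\<open>sum_div_Lcm_eq\<close> is the version truncated at \<open>m < M\<close>).

  After division by \<open>N\<close>, each term is at most \<open>1 / L m\<close> and tends to \<open>1 / L m\<close>. So the averages
  never exceed the sum of the series when it converges, and in every case they are eventually larger
  than anything below a given partial sum. These two facts settle both the convergent and the
  divergent case (\<open>averages_tendsto_suminf\<close>, \<open>averages_at_top\<close>).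
\<close>

section \<open>The smallest non-divisor and least common multiples\<close>

lemma smallest_nondivisor_properties:
  fixes A :: "nat set"
  assumes "infinite A" and "n > 0"
  shows "smallest_nondivisor A n \<in> A" and "\<not> smallest_nondivisor A n dvd n"
proof -
  obtain a where "a \<in> A" "n < a"
    using assms(1) by (auto simp: finite_nat_set_iff_bounded_le not_le)
  then have "a \<in> A \<and> \<not> a dvd n"
    using assms(2) by (auto dest: dvd_imp_le)
  from LeastI[where P = "\<lambda>a. a \<in> A \<and> \<not> a dvd n", OF this]
  show "smallest_nondivisor A n \<in> A" and "\<not> smallest_nondivisor A n dvd n"
    by (simp_all add: smallest_nondivisor_def)
qed

lemma Lcm_dvd_iff_less_smallest_nondivisor:
  fixes A :: "nat set"
  assumes "infinite A" and "n > 0"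
  shows "Lcm {a \<in> A. a \<le> m} dvd n \<longleftrightarrow> m < smallest_nondivisor A n"
proof
  assume "Lcm {a \<in> A. a \<le> m} dvd n"
  then have "a dvd n" if "a \<in> A" "a \<le> m" for a
    using that by (auto simp: Lcm_dvd_iff)
  then show "m < smallest_nondivisor A n"
    using smallest_nondivisor_properties[OF assms] by (meson not_le)
next
  assume "m < smallest_nondivisor A n"
  then have "a dvd n" if "a \<in> A" "a \<le> m" for a
    using that not_less_Least[of a "\<lambda>a. a \<in> A \<and> \<not> a dvd n"]
    unfolding smallest_nondivisor_def by auto
  then show "Lcm {a \<in> A. a \<le> m} dvd n"
    by (auto intro: Lcm_least)
qed

lemma div_eq_sum_of_bool_dvd:
  fixes d N :: nat
  assumes "d > 0"
  shows "N div d = (\<Sum>n = 1..N. of_bool (d dvd n))"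
proof (induction N)
  case 0
  then show ?case by simp
next
  case (Suc N)
  have "Suc N div d = N div d + of_bool (d dvd Suc N)"
    using assms by (auto simp: div_Suc dvd_eq_mod_eq_0)
  with Suc show ?case by simp
qed

text \<open>
  Both sides count the pairs \<open>(m, n)\<close> with \<open>m < M\<close>, \<open>1 \<le> n \<le> N\<close> and \<open>m\<close> below the smallest
  non-divisor of \<open>n\<close>. The truncation at \<open>M\<close> keeps all sums finite; it changes nothing once \<open>M\<close>
  exceeds the finitely many values \<open>smallest_nondivisor A n\<close>.
\<close>

lemma sum_div_Lcm_eq:
  fixes A :: "nat set"
  assumes "infinite A" and pos: "\<And>a. a \<in> A \<Longrightarrow> a > 0"
  shows "(\<Sum>m<M. N div Lcm {a \<in> A. a \<le> m}) = (\<Sum>n = 1..N. min M (smallest_nondivisor A n))"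
proof -
  have L: "Lcm {a \<in> A. a \<le> m} > 0" for m
    using pos[of 0] by (auto simp: Lcm_0_iff_nat intro!: Nat.gr0I)
  have "(\<Sum>m<M. N div Lcm {a \<in> A. a \<le> m})
      = (\<Sum>m<M. \<Sum>n = 1..N. of_bool (Lcm {a \<in> A. a \<le> m} dvd n))"
    by (simp only: div_eq_sum_of_bool_dvd[OF L])
  also have "\<dots> = (\<Sum>n = 1..N. \<Sum>m<M. of_bool (Lcm {a \<in> A. a \<le> m} dvd n))"
    by (rule sum.swap)
  also have "\<dots> = (\<Sum>n = 1..N. min M (smallest_nondivisor A n))"
  proof (rule sum.cong)
    fix n assume "n \<in> {1..N}"
    then have "(\<Sum>m<M. of_bool (Lcm {a \<in> A. a \<le> m} dvd n))
        = card {m \<in> {..<M}. m < smallest_nondivisor A n}"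
      using assms(1) by (simp add: Lcm_dvd_iff_less_smallest_nondivisor Int_def)
    also have "{m \<in> {..<M}. m < smallest_nondivisor A n} = {..<min M (smallest_nondivisor A n)}"
      by auto
    finally show "(\<Sum>m<M. of_bool (Lcm {a \<in> A. a \<le> m} dvd n)) = min M (smallest_nondivisor A n)"
      by simp
  qed simp
  finally show ?thesis .
qed

section \<open>Averages of sums of integer quotients\<close>

lemma div_over_self_le_inverse: "1 / real N * real (N div d) \<le> 1 / real d"
proof (cases "N = 0")
  case False
  have "real (N div d) \<le> real N / real d"
    using of_int_floor_le[of "real N / real d"] by (simp add: floor_divide_of_nat_eq)
  with False show ?thesis
    by (simp add: field_simps)
qed simp

lemma div_over_self_tendsto_inverse:
  "(\<lambda>N. 1 / real N * real (N div d)) \<longlonglongrightarrow> 1 / real d"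
proof (rule tendsto_sandwich)
  show "(\<lambda>N. 1 / real d - 1 / real N) \<longlonglongrightarrow> 1 / real d"
    using tendsto_diff[OF tendsto_const lim_1_over_n, of "1 / real d"] by simp
  show "\<forall>\<^sub>F N in sequentially. 1 / real d - 1 / real N \<le> 1 / real N * real (N div d)"
    using eventually_gt_at_top[of 0]
  proof eventually_elim
    case (elim N)
    have "real N / real d - 1 \<le> real (N div d)"
      using floor_correct[of "real N / real d"] by (simp add: floor_divide_of_nat_eq)
    then have "1 / real N * (real N / real d - 1) \<le> 1 / real N * real (N div d)"
      by (intro mult_left_mono) auto
    then show ?case
      using elim by (simp add: right_diff_distrib)
  qed
  show "\<forall>\<^sub>F N in sequentially. 1 / real N * real (N div d) \<le> 1 / real d"
    by (simp only: div_over_self_le_inverse eventually_True)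
qed (rule tendsto_const)

text \<open>
  Only the first \<open>M\<close> quotients are used, and each of them, divided by \<open>N\<close>, tends to \<open>1 / L m\<close>; so the
  partial sums of the series are lower bounds for the averages in the limit.
\<close>

lemma eventually_average_gt:
  fixes L :: "nat \<Rightarrow> nat" and S :: "nat \<Rightarrow> real"
  assumes lower: "\<And>M N. (\<Sum>m<M. real (N div L m)) \<le> S N"
    and "c < (\<Sum>m<M. 1 / real (L m))"
  shows "\<forall>\<^sub>F N in sequentially. c < 1 / real N * S N"
proof -
  have "(\<lambda>N. \<Sum>m<M. 1 / real N * real (N div L m)) \<longlonglongrightarrow> (\<Sum>m<M. 1 / real (L m))"
    by (intro tendsto_sum div_over_self_tendsto_inverse)
  from order_tendstoD(1)[OF this assms(2)]
  show ?thesis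
  proof eventually_elim
    case (elim N)
    also have "(\<Sum>m<M. 1 / real N * real (N div L m)) \<le> 1 / real N * S N"
      unfolding sum_distrib_left[symmetric] by (intro mult_left_mono lower) simp
    finally show ?case .
  qed
qed

lemma averages_tendsto_suminf:
  fixes L :: "nat \<Rightarrow> nat" and S :: "nat \<Rightarrow> real"
  assumes lower: "\<And>M N. (\<Sum>m<M. real (N div L m)) \<le> S N"
    and attained: "\<And>N. \<exists>M. S N = (\<Sum>m<M. real (N div L m))"
    and summable: "summable (\<lambda>m. 1 / real (L m))"
  shows "(\<lambda>N. 1 / real N * S N) \<longlonglongrightarrow> (\<Sum>m. 1 / real (L m))"
proof (rule order_tendstoI)
  fix c assume "c < (\<Sum>m. 1 / real (L m))"
  then obtain M where "c < (\<Sum>m<M. 1 / real (L m))"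
    using order_tendstoD(1)[OF summable_LIMSEQ[OF summable]]
    by (auto simp: eventually_sequentially)
  then show "\<forall>\<^sub>F N in sequentially. c < 1 / real N * S N"
    by (rule eventually_average_gt[OF lower])
next
  fix c assume c: "(\<Sum>m. 1 / real (L m)) < c"
  have "1 / real N * S N \<le> (\<Sum>m. 1 / real (L m))" for N
  proof -
    obtain M where "S N = (\<Sum>m<M. real (N div L m))"
      using attained by blast
    then have "1 / real N * S N = (\<Sum>m<M. 1 / real N * real (N div L m))"
      by (simp only: sum_distrib_left)
    also have "\<dots> \<le> (\<Sum>m<M. 1 / real (L m))"
      by (intro sum_mono div_over_self_le_inverse)
    also have "\<dots> \<le> (\<Sum>m. 1 / real (L m))"
      by (intro sum_le_suminf summable) auto
    finally show ?thesis .
  qed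
  with c show "\<forall>\<^sub>F N in sequentially. 1 / real N * S N < c"
    by (intro always_eventually allI) (rule le_less_trans)
qed

lemma averages_at_top:
  fixes L :: "nat \<Rightarrow> nat" and S :: "nat \<Rightarrow> real"
  assumes lower: "\<And>M N. (\<Sum>m<M. real (N div L m)) \<le> S N"
    and divergent: "\<not> summable (\<lambda>m. 1 / real (L m))"
  shows "filterlim (\<lambda>N. 1 / real N * S N) at_top sequentially"
  unfolding filterlim_at_top_dense
proof
  fix c :: real
  obtain M where "c < (\<Sum>m<M. 1 / real (L m))"
    using divergent summableI_nonneg_bounded[of "\<lambda>m. 1 / real (L m)" c]
    by (auto simp: not_le[symmetric])
  then show "\<forall>\<^sub>F N in sequentially. c < 1 / real N * S N"
    by (rule eventually_average_gt[OF lower])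
qed

section \<open>The mean value of the smallest non-divisor\<close>

theorem theorem1:
  fixes A :: "nat set"
  assumes "infinite A" and "\<And>a. a \<in> A \<Longrightarrow> a > 0"
  shows "(summable (\<lambda>n::nat. 1 / real (Lcm {a \<in> A. a \<le> n})) \<longrightarrow>
            (\<lambda>N::nat. 1 / real N * (\<Sum>n = 1..N. real (smallest_nondivisor A n)))
              \<longlonglongrightarrow> (\<Sum>n::nat. 1 / real (Lcm {a \<in> A. a \<le> n})))
       \<and> (\<not> summable (\<lambda>n::nat. 1 / real (Lcm {a \<in> A. a \<le> n})) \<longrightarrow>
            filterlim (\<lambda>N::nat. 1 / real N * (\<Sum>n = 1..N. real (smallest_nondivisor A n)))
              at_top sequentially)"
proof -
  define L where "L m = Lcm {a \<in> A. a \<le> m}" for m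
  define S where "S N = (\<Sum>n = 1..N. real (smallest_nondivisor A n))" for N
  have trunc: "(\<Sum>m<M. real (N div L m)) = (\<Sum>n = 1..N. real (min M (smallest_nondivisor A n)))"
    for M N
    unfolding L_def of_nat_sum[symmetric] by (simp only: sum_div_Lcm_eq[OF assms])
  have lower: "(\<Sum>m<M. real (N div L m)) \<le> S N" for M N
    unfolding trunc S_def by (intro sum_mono) simp
  have attained: "\<exists>M. S N = (\<Sum>m<M. real (N div L m))" for N
  proof
    \<comment> \<open>Any upper bound for the values up to \<open>N\<close> would do; their sum is one.\<close>
    let ?M = "\<Sum>n = 1..N. smallest_nondivisor A n"
    have "smallest_nondivisor A n \<le> ?M" if "n \<in> {1..N}" for n
      using that by (intro member_le_sum) auto
    then show "S N = (\<Sum>m<?M. real (N div L m))"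
      unfolding trunc S_def by (intro sum.cong) (simp_all add: min_absorb2)
  qed
  show ?thesis
    using averages_tendsto_suminf[OF lower attained] averages_at_top[OF lower]
    unfolding L_def S_def by blast
qed

end
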